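(* Let $(L,\mu_0,m_0,\alpha)$ be a compatible Hom-Leibniz algebra, and let $(L,\mu_t,m_t,\alpha)$ and $(L,\mu_t',m_t',\alpha)$ be two infinitesimal deformations of it, generated by $(\mu_1,m_1)$ and $(\mu_1',m_1')$ respectively. If these two infinitesimal deformations are equivalent, then $(\mu_1,m_1)$ and $(\mu_1',m_1')$ are in the same cohomology class in $H_\alpha^2(L,L)$.
   Context: $K$ is a field of characteristic $0$. Hom-Leibniz algebra: a triple $(L,[\cdot,\cdot],\alpha)$ with $L$ a $K$-vector space, $[\cdot,\cdot]:L\otimes L\to L$ and $\alpha:L\to L$ linear, such that $[\alpha(x),[y,z]]=[[x,y],\alpha(z)]+[\alpha(y),[x,z]]$ for all $x,y,z\in L$. All Hom-Leibniz algebras are assumed multiplicative: $\alpha([x,y])=[\alpha(x),\alpha(y)]$. Compatible Hom-Leibniz algebra: a quadruple $(L,[\cdot,\cdot],\{\cdot,\cdot\},\alpha)$ such that $(L,[\cdot,\cdot],\alpha)$ and $(L,\{\cdot,\cdot\},\alpha)$ are Hom-Leibniz algebras and for all $x,y,z\in L$ $$[\alpha(x),\{y,z\}]+\{\alpha(x),[y,z]\}=[\{x,y\},\alpha(z)]+\{[x,y],\alpha(z)\}+[\alpha(y),\{x,z\}]+\{\alpha(y),[x,z]\}.$$ A homomorphism $(L_1,[\cdot,\cdot]_1,\{\cdot,\cdot\}_1,\alpha_1)\to(L_2,[\cdot,\cdot]_2,\{\cdot,\cdot\}_2,\alpha_2)$ is a linear map $\phi:L_1\to L_2$ with $\phi([x,y]_1)=[\phi(x),\phi(y)]_2$,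 $\phi(\{x,y\}_1)=\{\phi(x),\phi(y)\}_2$ and $\phi\circ\alpha_1=\alpha_2\circ\phi$. Cochains: for $n\ge1$, $\mathbb C_\alpha^n(L,L)=\{f\in \mathrm{Hom}(L^{\otimes n},L)\mid \alpha\circ f=f\circ\alpha^{\otimes n}\}$, with elements of $\mathbb C_\alpha^n(L,L)$ in degree $n-1$. Balavoine bracket: for $P\in\mathbb C_\alpha^{p+1}(L,L)$, $Q\in\mathbb C_\alpha^{q+1}(L,L)$, $[P,Q]_B=P\circ Q-(-1)^{pq}Q\circ P$, where $P\circ Q=\sum_{k=1}^{p+1}(-1)^{(k-1)q}P\circ_kQ\in \mathbb C_\alpha^{p+q+1}(L,L)$ and $$(P\circ_kQ)(x_1,\dots,x_{p+q+1})=\sum_{\sigma\in S_{(k-1,q)}}(-1)^\sigma P\big(\alpha^q(x_{\sigma(1)}),\dots,\alpha^q(x_{\sigma(k-1)}),Q(x_{\sigma(k)},\dots,x_{\sigma(k+q-1)},x_{k+q}),\alpha^q(x_{k+q+1}),\dots,\alpha^q(x_{p+q+1})\big).$$ Here $S_{(i,n-i)}$ is the set of $\sigma\in S_n$ with $\sigma(1)<\dots<\sigma(i)$ and $\sigma(i+1)<\dots<\sigma(n)$ (only the identity if $i=0$ or $i=n$), and $(-1)^\sigma$ is the sign. Cohomology of the compatible Hom-Leibniz algebra $(L,\mu_0,m_0,\alpha)$: put $\pi_1=\mu_0$, $\pi_2=m_0$, and let $LC_\alpha^n(L,L)$ be the direct sum of $n$ copies of $\mathbb C_\alpha^n(L,L)$,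 $n\ge1$. Define $d^1f=([\pi_1,f]_B,[\pi_2,f]_B)$ and, for $n\ge2$, $d^n(f_1,\dots,f_n)=(-1)^{n-1}(g_1,\dots,g_{n+1})$, where $g_1=[\pi_1,f_1]_B$, $g_i=[\pi_2,f_{i-1}]_B+[\pi_1,f_i]_B$ for $2\le i\le n$, $g_{n+1}=[\pi_2,f_n]_B$. This is a cochain complex, with cohomology groups denoted $H_\alpha^n(L,L)$; in particular $H_\alpha^2(L,L)=\ker d^2/\operatorname{im}d^1$. Infinitesimal deformation: for $\mu_1,m_1\in\mathbb C_\alpha^2(L,L)$ put $\mu_t(x,y)=\mu_0(x,y)+t\mu_1(x,y)$ and $m_t(x,y)=m_0(x,y)+tm_1(x,y)$. If $(L,\mu_t,m_t,\alpha)$ is a compatible Hom-Leibniz algebra for every $t$ (in $K$), then $(L,\mu_t,m_t,\alpha)$ is an infinitesimal deformation of $(L,\mu_0,m_0,\alpha)$, and $(\mu_1,m_1)$ is said to generate it; in this case $(\mu_1,m_1)$ is a $2$-cocycle. Similarly $\mu_t'=\mu_0+t\mu_1'$, $m_t'=m_0+tm_1'$. Equivalence: two infinitesimal deformations $(L,\mu_t,m_t,\alpha)$ and $(L,\mu_t',m_t',\alpha)$ of $(L,\mu_0,m_0,\alpha)$ are equivalent if there is a linear map $N:L\to L$ (independent of $t$) such that $\mathrm{Id}+tN:(L,\mu_t,m_t,\alpha)\to(L,\mu_t',m_t',\alpha)$ is a homomorphism of compatible Hom-Leibniz algebras for every $t$. *)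

theory Defs
  imports Complex_Main "HOL-Combinatorics.Permutations" "HOL-Algebra.Coset"
begin

text \<open>
  The vector space \<open>L\<close> is the type \<open>'v\<close> with scalar multiplication \<open>scale\<close> over the field \<open>'k\<close>
  of characteristic 0. Hom-Leibniz algebras are multiplicative throughout.
\<close>

locale hom_leibniz_algebra = vector_space scale
  for scale :: "'k::field_char_0 \<Rightarrow> 'v::ab_group_add \<Rightarrow> 'v" +
  fixes br :: "'v \<Rightarrow> 'v \<Rightarrow> 'v" and \<alpha> :: "'v \<Rightarrow> 'v"
  assumes br_linear_left: "Vector_Spaces.linear scale scale (\<lambda>x. br x y)"
    and br_linear_right: "Vector_Spaces.linear scale scale (\<lambda>y. br x y)"
    and \<alpha>_linear: "Vector_Spaces.linear scale scale \<alpha>"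
    and hom_leibniz: "br (\<alpha> x) (br y z) = br (br x y) (\<alpha> z) + br (\<alpha> y) (br x z)"
    and multiplicative: "\<alpha> (br x y) = br (\<alpha> x) (\<alpha> y)"

locale compatible_hom_leibniz_algebra =
  first: hom_leibniz_algebra scale \<mu> \<alpha> + second: hom_leibniz_algebra scale m \<alpha>
  for scale :: "'k::field_char_0 \<Rightarrow> 'v::ab_group_add \<Rightarrow> 'v"
    and \<mu> m :: "'v \<Rightarrow> 'v \<Rightarrow> 'v" and \<alpha> :: "'v \<Rightarrow> 'v" +
  assumes compatible:
    "\<mu> (\<alpha> x) (m y z) + m (\<alpha> x) (\<mu> y z)
      = \<mu> (m x y) (\<alpha> z) + m (\<mu> x y) (\<alpha> z) + \<mu> (\<alpha> y) (m x z) + m (\<alpha> y) (\<mu> x z)"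

locale compatible_hom_leibniz_hom =
  source: compatible_hom_leibniz_algebra scale1 \<mu>1 m1 \<alpha>1 +
  target: compatible_hom_leibniz_algebra scale2 \<mu>2 m2 \<alpha>2
  for scale1 :: "'k::field_char_0 \<Rightarrow> 'v::ab_group_add \<Rightarrow> 'v" and \<mu>1 m1 \<alpha>1
    and scale2 :: "'k \<Rightarrow> 'w::ab_group_add \<Rightarrow> 'w" and \<mu>2 m2 \<alpha>2 +
  fixes \<phi> :: "'v \<Rightarrow> 'w"
  assumes \<phi>_linear: "Vector_Spaces.linear scale1 scale2 \<phi>"
    and \<phi>_\<mu>: "\<phi> (\<mu>1 x y) = \<mu>2 (\<phi> x) (\<phi> y)"
    and \<phi>_m: "\<phi> (m1 x y) = m2 (\<phi> x) (\<phi> y)"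
    and \<phi>_\<alpha>: "\<phi> \<circ> \<alpha>1 = \<alpha>2 \<circ> \<phi>"

definition unshuffles :: "nat \<Rightarrow> nat \<Rightarrow> (nat \<Rightarrow> nat) set" where
  "unshuffles i j = {\<sigma>. \<sigma> permutes {1..i + j} \<and>
     strict_mono_on {1..i} \<sigma> \<and> strict_mono_on {i + 1..i + j} \<sigma>}"

text \<open>
  An \<open>n\<close>-cochain is a multilinear map on lists of length \<open>n\<close>; it is set to 0 on lists of any other
  length, so that equality of cochains is equality of functions.
\<close>

definition cochain2 :: "('v::zero \<Rightarrow> 'v \<Rightarrow> 'v) \<Rightarrow> 'v list \<Rightarrow> 'v" where
  "cochain2 \<mu> xs = (if length xs = 2 then \<mu> (xs ! 0) (xs ! 1) else 0)"

context
  fixes scale :: "'k::field_char_0 \<Rightarrow> 'v::ab_group_add \<Rightarrow> 'v"  (infixr "*s" 75)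
    and \<alpha> :: "'v \<Rightarrow> 'v"
begin

definition cochains :: "nat \<Rightarrow> ('v list \<Rightarrow> 'v) set" where
  "cochains n = {f.
     (\<forall>xs. length xs \<noteq> n \<longrightarrow> f xs = 0) \<and>
     (\<forall>xs i. length xs = n \<longrightarrow> i < n \<longrightarrow> Vector_Spaces.linear scale scale (\<lambda>y. f (xs[i := y]))) \<and>
     (\<forall>xs. length xs = n \<longrightarrow> \<alpha> (f xs) = f (map \<alpha> xs))}"

text \<open>
  In the following operations \<open>P\<close> has arity \<open>p + 1\<close> and \<open>Q\<close> has arity \<open>q + 1\<close>, i.e. \<open>p\<close> and \<open>q\<close>
  are the degrees.
\<close>

definition insertion ::
  "nat \<Rightarrow> ('v list \<Rightarrow> 'v) \<Rightarrow> nat \<Rightarrow> ('v list \<Rightarrow> 'v) \<Rightarrow> nat \<Rightarrow> 'v list \<Rightarrow> 'v" where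
  "insertion p P q Q k xs =
     (let x = (\<lambda>i. xs ! (i - 1)) in
      \<Sum>\<sigma>\<in>unshuffles (k - 1) q. of_int (sign \<sigma>) *s
        P (map (\<lambda>i. (\<alpha> ^^ q) (x (\<sigma> i))) [1..<k]
           @ [Q (map (\<lambda>i. x (\<sigma> i)) [k..<k + q] @ [x (k + q)])]
           @ map (\<lambda>i. (\<alpha> ^^ q) (x i)) [k + q + 1..<p + q + 2]))"

definition circle ::
  "nat \<Rightarrow> ('v list \<Rightarrow> 'v) \<Rightarrow> nat \<Rightarrow> ('v list \<Rightarrow> 'v) \<Rightarrow> 'v list \<Rightarrow> 'v" where
  "circle p P q Q xs =
     (if length xs = p + q + 1
      then \<Sum>k = 1..p + 1. (- 1) ^ ((k - 1) * q) *s insertion p P q Q k xs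
      else 0)"

definition balavoine ::
  "nat \<Rightarrow> ('v list \<Rightarrow> 'v) \<Rightarrow> nat \<Rightarrow> ('v list \<Rightarrow> 'v) \<Rightarrow> 'v list \<Rightarrow> 'v" where
  "balavoine p P q Q xs = circle p P q Q xs - (- 1) ^ (p * q) *s circle q Q p P xs"

text \<open>The \<open>n\<close>-tuples in \<open>LC n\<close> are lists; the group operation is componentwise addition.\<close>

definition LC :: "nat \<Rightarrow> ('v list \<Rightarrow> 'v) list monoid" where
  "LC n = \<lparr>carrier = {fs. length fs = n \<and> set fs \<subseteq> cochains n},
           monoid.mult = map2 (\<lambda>f g xs. f xs + g xs),
           one = replicate n (\<lambda>xs. 0)\<rparr>"

text \<open>
  \<open>\<mu>\<close> and \<open>m\<close> are the two brackets of the algebra. For \<open>n = 1\<close> the tuple below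
  is \<open>([\<pi>1, f], [\<pi>2, f])\<close> with sign \<open>+1\<close>.
\<close>

definition differential ::
  "('v \<Rightarrow> 'v \<Rightarrow> 'v) \<Rightarrow> ('v \<Rightarrow> 'v \<Rightarrow> 'v) \<Rightarrow> nat \<Rightarrow> ('v list \<Rightarrow> 'v) list \<Rightarrow> ('v list \<Rightarrow> 'v) list" where
  "differential \<mu> m n fs =
     (let \<pi>1 = cochain2 \<mu>; \<pi>2 = cochain2 m; f = (\<lambda>i. fs ! (i - 1));
          g = (\<lambda>i. if i = 1 then balavoine 1 \<pi>1 (n - 1) (f 1)
                   else if i = n + 1 then balavoine 1 \<pi>2 (n - 1) (f n)
                   else (\<lambda>xs. balavoine 1 \<pi>2 (n - 1) (f (i - 1)) xs
                              + balavoine 1 \<pi>1 (n - 1) (f i) xs))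
      in map (\<lambda>i xs. (- 1) ^ (n - 1) *s g i xs) [1..<n + 2])"

definition cocycles ::
  "('v \<Rightarrow> 'v \<Rightarrow> 'v) \<Rightarrow> ('v \<Rightarrow> 'v \<Rightarrow> 'v) \<Rightarrow> nat \<Rightarrow> ('v list \<Rightarrow> 'v) list set" where
  "cocycles \<mu> m n = kernel (LC n) (LC (n + 1)) (differential \<mu> m n)"

text \<open>The complex starts in degree 1, hence there are no nonzero 1-coboundaries.\<close>

definition coboundaries ::
  "('v \<Rightarrow> 'v \<Rightarrow> 'v) \<Rightarrow> ('v \<Rightarrow> 'v \<Rightarrow> 'v) \<Rightarrow> nat \<Rightarrow> ('v list \<Rightarrow> 'v) list set" where
  "coboundaries \<mu> m n =
     (if n \<le> 1 then {\<one>\<^bsub>LC n\<^esub>} else differential \<mu> m (n - 1) ` carrier (LC (n - 1)))"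

definition cohomology ::
  "('v \<Rightarrow> 'v \<Rightarrow> 'v) \<Rightarrow> ('v \<Rightarrow> 'v \<Rightarrow> 'v) \<Rightarrow> nat \<Rightarrow> ('v list \<Rightarrow> 'v) list set monoid" where
  "cohomology \<mu> m n = (LC n)\<lparr>carrier := cocycles \<mu> m n\<rparr> Mod coboundaries \<mu> m n"

definition deform :: "('v \<Rightarrow> 'v \<Rightarrow> 'v) \<Rightarrow> ('v \<Rightarrow> 'v \<Rightarrow> 'v) \<Rightarrow> 'k \<Rightarrow> 'v \<Rightarrow> 'v \<Rightarrow> 'v" where
  "deform \<mu>0 \<mu>1 t x y = \<mu>0 x y + t *s \<mu>1 x y"

definition generates_infinitesimal_deformation ::
  "('v \<Rightarrow> 'v \<Rightarrow> 'v) \<Rightarrow> ('v \<Rightarrow> 'v \<Rightarrow> 'v) \<Rightarrow> ('v \<Rightarrow> 'v \<Rightarrow> 'v) \<Rightarrow> ('v \<Rightarrow> 'v \<Rightarrow> 'v) \<Rightarrow> bool" where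
  "generates_infinitesimal_deformation \<mu>0 m0 \<mu>1 m1 \<longleftrightarrow>
     cochain2 \<mu>1 \<in> cochains 2 \<and> cochain2 m1 \<in> cochains 2 \<and>
     (\<forall>t. compatible_hom_leibniz_algebra scale (deform \<mu>0 \<mu>1 t) (deform m0 m1 t) \<alpha>)"

definition equivalent_deformations ::
  "('v \<Rightarrow> 'v \<Rightarrow> 'v) \<Rightarrow> ('v \<Rightarrow> 'v \<Rightarrow> 'v) \<Rightarrow> ('v \<Rightarrow> 'v \<Rightarrow> 'v) \<Rightarrow> ('v \<Rightarrow> 'v \<Rightarrow> 'v)
    \<Rightarrow> ('v \<Rightarrow> 'v \<Rightarrow> 'v) \<Rightarrow> ('v \<Rightarrow> 'v \<Rightarrow> 'v) \<Rightarrow> bool" where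
  "equivalent_deformations \<mu>0 m0 \<mu>1 m1 \<mu>1' m1' \<longleftrightarrow>
     (\<exists>N. Vector_Spaces.linear scale scale N \<and>
       (\<forall>t. compatible_hom_leibniz_hom
              scale (deform \<mu>0 \<mu>1 t) (deform m0 m1 t) \<alpha>
              scale (deform \<mu>0 \<mu>1' t) (deform m0 m1' t) \<alpha>
              (\<lambda>x. x + t *s N x)))"

end

end

theory Submission
  imports Defs
begin

text \<open>
  Every identity required of a deformation is polynomial in \<open>t\<close>, and since \<open>K\<close> is infinite its
  coefficients vanish separately. The coefficients of \<open>t\<close> in the compatible Hom-Leibniz identities
  say that \<open>(\<mu>1, m1)\<close> is a cocycle; the coefficients of \<open>t\<close> in the homomorphism identities for
  \<open>Id + t N\<close> say that \<open>(\<mu>1, m1) - (\<mu>1', m1')\<close> is the coboundary of \<open>N\<close>.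
\<close>

section \<open>Unshuffles in low arity\<close>

lemma unshuffles_small:
  "unshuffles 0 0 = {id}" "unshuffles 0 (Suc 0) = {id}" "unshuffles (Suc 0) 0 = {id}"
  by (auto simp: unshuffles_def strict_mono_on_def)

lemma unshuffles_1_1: "unshuffles (Suc 0) (Suc 0) = {id, transpose (Suc 0) 2}"
proof -
  have *: "{1..Suc 0 + Suc 0} = {1, 2::nat}" by auto
  have "\<sigma> \<in> {id, transpose 1 2}" if "\<sigma> permutes {1, 2}" for \<sigma> :: "nat \<Rightarrow> nat"
    using that unfolding permutes_doubleton_iff by auto
  moreover have "transpose 1 2 permutes {1, 2::nat}"
    by (rule permutes_swap_id) auto
  moreover have "id permutes {1, 2::nat}"
    by (rule permutes_id)
  ultimately show ?thesis
    unfolding unshuffles_def * by (auto simp: strict_mono_on_def)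
qed

section \<open>Bilinear brackets and the Leibniz defect\<close>

definition bilinear_over ::
  "('k::field \<Rightarrow> 'v::ab_group_add \<Rightarrow> 'v) \<Rightarrow> ('v \<Rightarrow> 'v \<Rightarrow> 'v) \<Rightarrow> bool" where
  "bilinear_over scale P \<longleftrightarrow>
     (\<forall>y. Vector_Spaces.linear scale scale (\<lambda>x. P x y)) \<and>
     (\<forall>x. Vector_Spaces.linear scale scale (P x))"

lemma bilinear_over_add:
  assumes "bilinear_over scale P"
  shows "P (x + x') y = P x y + P x' y" "P x (y + y') = P x y + P x y'"
proof -
  interpret l: Vector_Spaces.linear scale scale "\<lambda>x. P x y"
    using assms by (simp add: bilinear_over_def)
  interpret r: Vector_Spaces.linear scale scale "P x"
    using assms by (simp add: bilinear_over_def)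
  show "P (x + x') y = P x y + P x' y" "P x (y + y') = P x y + P x y'"
    by (rule l.add r.add)+
qed

lemma bilinear_over_scale:
  assumes "bilinear_over scale P"
  shows "P (scale a x) y = scale a (P x y)" "P x (scale a y) = scale a (P x y)"
proof -
  interpret l: Vector_Spaces.linear scale scale "\<lambda>x. P x y"
    using assms by (simp add: bilinear_over_def)
  interpret r: Vector_Spaces.linear scale scale "P x"
    using assms by (simp add: bilinear_over_def)
  show "P (scale a x) y = scale a (P x y)" "P x (scale a y) = scale a (P x y)"
    by (rule l.scale r.scale)+
qed

lemma bilinear_over_cochain2:
  assumes "cochain2 P \<in> cochains scale \<alpha> 2"
  shows "bilinear_over scale P"
proof -
  \<comment> \<open>Leaving the list update unevaluated keeps the shape of the multilinearity clause
    in \<open>cochains\<close>; slots 0 and 1 then give the two linearities.\<close>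
  have lin: "Vector_Spaces.linear scale scale (\<lambda>u. cochain2 P ([x, y][i := u]))" if "i < 2" for x y i
    using assms that by (simp add: cochains_def del: list_update.simps)
  show ?thesis
    using lin[of 0] lin[of 1, simplified] by (simp add: bilinear_over_def cochain2_def)
qed

lemma (in hom_leibniz_algebra) bilinear_over_br: "bilinear_over scale br"
  unfolding bilinear_over_def using br_linear_left br_linear_right by simp

lemma (in hom_leibniz_algebra) br_zero: "br 0 y = 0" "br x 0 = 0"
  using bilinear_over_add(1)[OF bilinear_over_br, of 0 0 y]
    bilinear_over_add(2)[OF bilinear_over_br, of x 0 0]
  by simp_all

text \<open>Polarised form of the Hom-Leibniz identity: the diagonal \<open>P = Q\<close> vanishes
  exactly when that identity holds for \<open>P\<close>, and the symmetrisation in \<open>P\<close>,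
  \<open>Q\<close> vanishes exactly when the compatibility condition holds.\<close>

definition leibniz_defect ::
  "('v \<Rightarrow> 'v) \<Rightarrow> ('v \<Rightarrow> 'v \<Rightarrow> 'v) \<Rightarrow> ('v \<Rightarrow> 'v \<Rightarrow> 'v) \<Rightarrow> 'v \<Rightarrow> 'v \<Rightarrow> 'v \<Rightarrow> 'v::ab_group_add" where
  "leibniz_defect \<alpha> P Q x y z = P (\<alpha> x) (Q y z) - P (Q x y) (\<alpha> z) - P (\<alpha> y) (Q x z)"

context
  fixes scale :: "'k::field_char_0 \<Rightarrow> 'v::ab_group_add \<Rightarrow> 'v"  (infixr "*s" 75)
    and \<alpha> :: "'v \<Rightarrow> 'v"
  assumes vector_space_scale: "vector_space scale"
begin

interpretation vector_space scale
  by (fact vector_space_scale)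

text \<open>A cubic without constant term is determined by its values at three distinct nonzero
  parameters; 1, -1 and 2 qualify in characteristic 0. Degree 3 occurs in the homomorphism identity,
  where both arguments of a deformed bracket depend on t.\<close>

lemma linear_coeff_eq_0:
  assumes "\<And>t. t *s A + (t * t) *s B + (t * t * t) *s C = 0"
  shows "A = 0"
proof -
  have 1: "A + B + C = 0" and 2: "- A + B - C = 0" and 3: "2 *s A + 4 *s B + 8 *s C = 0"
    using assms[of 1] assms[of "-1"] assms[of 2] by simp_all
  have "2 *s B = B + B"
    using scale_left_distrib[of 1 1 B] by simp
  also have "\<dots> = (A + B + C) + (- A + B - C)"
    by simp
  finally have "B = 0"
    using 1 2 by simp
  with 1 have "C = - A"
    by (simp add: eq_neg_iff_add_eq_0 add.commute)
  \<comment> \<open>At t = 2, putting B = 0 and C = -A leaves -6 A = 0.\<close>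
  with 3 \<open>B = 0\<close> have "(2 - 8) *s A = 0"
    by (simp only: scale_left_diff_distrib) simp
  then show ?thesis by simp
qed

section \<open>Balavoine brackets in low degree\<close>

lemma balavoine_eq_0_length: "length xs \<noteq> p + q + 1 \<Longrightarrow> balavoine scale \<alpha> p P q Q xs = 0"
  by (simp add: balavoine_def circle_def add.commute)

lemma balavoine_1_0:
  "balavoine scale \<alpha> 1 (cochain2 P) 0 Q [x, y] = P (Q [x]) y + P x (Q [y]) - Q [P x y]"
proof -
  have *: "{1..Suc 0 + 1} = {1, 2::nat}" by auto
  show ?thesis
    by (simp add: balavoine_def circle_def insertion_def Let_def * upt_rec sign_id
      numeral_2_eq_2 unshuffles_small cochain2_def)
qed

text \<open>For p = q = 1 the sign in the bracket is -1, so the two circle products add up. Each is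
  minus a defect: k = 1 gives the term with \<open>z\<close> outside, and k = 2, with sign -1, gives
  the two others via the identity and the transposition.\<close>

lemma balavoine_1_1:
  "balavoine scale \<alpha> 1 (cochain2 P) 1 (cochain2 Q) [x, y, z] =
     - (leibniz_defect \<alpha> P Q x y z + leibniz_defect \<alpha> Q P x y z)"
proof -
  have *: "{1..Suc 0 + 1} = {1, 2::nat}" by auto
  \<comment> \<open>Distinctness makes the sum over the two unshuffles have two terms.\<close>
  have "id \<noteq> transpose (Suc 0) 2"
    by (metis id_apply n_not_Suc_n numeral_2_eq_2 transpose_apply_first)
  then show ?thesis
    by (simp add: balavoine_def circle_def insertion_def Let_def * upt_rec sign_id sign_swap_id
      numeral_2_eq_2 unshuffles_small unshuffles_1_1 cochain2_def leibniz_defect_def)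
qed

section \<open>Deformation generators are cocycles\<close>

lemma leibniz_defect_deform:
  assumes "bilinear_over scale P" "bilinear_over scale P'"
  shows "leibniz_defect \<alpha> (deform scale P P' t) (deform scale Q Q' t) x y z =
    leibniz_defect \<alpha> P Q x y z
    + t *s (leibniz_defect \<alpha> P Q' x y z + leibniz_defect \<alpha> P' Q x y z)
    + (t * t) *s leibniz_defect \<alpha> P' Q' x y z"
  by (simp add: leibniz_defect_def deform_def assms[THEN bilinear_over_add(1)]
      assms[THEN bilinear_over_add(2)] assms[THEN bilinear_over_scale(1)]
      assms[THEN bilinear_over_scale(2)] scale_right_distrib scale_right_diff_distrib)

lemma deformation_generator_in_cocycles:
  assumes alg: "compatible_hom_leibniz_algebra scale \<mu>0 m0 \<alpha>"
    and gen: "generates_infinitesimal_deformation scale \<alpha> \<mu>0 m0 \<mu>1 m1"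
  shows "[cochain2 \<mu>1, cochain2 m1] \<in> cocycles scale \<alpha> \<mu>0 m0 2"
proof -
  let ?J = "leibniz_defect \<alpha>" and ?\<mu> = "deform scale \<mu>0 \<mu>1" and ?m = "deform scale m0 m1"
  interpret compatible_hom_leibniz_algebra scale \<mu>0 m0 \<alpha> by (fact alg)
  have cochains: "cochain2 \<mu>1 \<in> cochains scale \<alpha> 2" "cochain2 m1 \<in> cochains scale \<alpha> 2"
    and deform: "\<And>t. compatible_hom_leibniz_algebra scale (?\<mu> t) (?m t) \<alpha>"
    using gen by (simp_all add: generates_infinitesimal_deformation_def)
  note bilinear = first.bilinear_over_br second.bilinear_over_br
    cochains[THEN bilinear_over_cochain2]
  have J_alg: "?J \<mu> \<mu> x y z = 0 \<and> ?J m m x y z = 0 \<and> ?J \<mu> m x y z + ?J m \<mu> x y z = 0"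
    if "compatible_hom_leibniz_algebra scale \<mu> m \<alpha>" for \<mu> m x y z
  proof -
    interpret A: compatible_hom_leibniz_algebra scale \<mu> m \<alpha> by fact
    show ?thesis
      using A.first.hom_leibniz[of x y z] A.second.hom_leibniz[of x y z] A.compatible[of x y z]
      by (simp add: leibniz_defect_def algebra_simps)
  qed
  note J0 = J_alg[OF alg]
  \<comment> \<open>The constant coefficient is an axiom of the undeformed algebra, so only the
    powers t and t^2 remain.\<close>
  have J1: "?J \<mu>0 \<mu>1 x y z + ?J \<mu>1 \<mu>0 x y z = 0" for x y z
    by (rule linear_coeff_eq_0[of _ "?J \<mu>1 \<mu>1 x y z" 0])
      (use J_alg[OF deform] J0 in \<open>simp add: leibniz_defect_deform bilinear\<close>)
  have J2: "?J m0 m1 x y z + ?J m1 m0 x y z = 0" for x y z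
    by (rule linear_coeff_eq_0[of _ "?J m1 m1 x y z" 0])
      (use J_alg[OF deform] J0 in \<open>simp add: leibniz_defect_deform bilinear\<close>)
  \<comment> \<open>Grouped to match the middle component of the differential, which pairs
    \<open>m0\<close> with \<open>\<mu>1\<close> and \<open>\<mu>0\<close> with
    \<open>m1\<close>.\<close>
  have J3: "(?J m0 \<mu>1 x y z + ?J \<mu>1 m0 x y z) + (?J \<mu>0 m1 x y z + ?J m1 \<mu>0 x y z) = 0"
    for x y z
  proof (rule linear_coeff_eq_0[of _ "?J \<mu>1 m1 x y z + ?J m1 \<mu>1 x y z" 0])
    fix t
    have "?J (?\<mu> t) (?m t) x y z + ?J (?m t) (?\<mu> t) x y z - (?J \<mu>0 m0 x y z + ?J m0 \<mu>0 x y z) = 0"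
      using J_alg[OF deform] J0 by simp
    then show "t *s ((?J m0 \<mu>1 x y z + ?J \<mu>1 m0 x y z) + (?J \<mu>0 m1 x y z + ?J m1 \<mu>0 x y z))
      + (t * t) *s (?J \<mu>1 m1 x y z + ?J m1 \<mu>1 x y z) + (t * t * t) *s 0 = 0"
      by (simp add: leibniz_defect_deform bilinear scale_right_distrib algebra_simps)
  qed
  have bracket:
    "balavoine scale \<alpha> 1 (cochain2 \<mu>0) 1 (cochain2 \<mu>1) xs = 0 \<and>
     balavoine scale \<alpha> 1 (cochain2 m0) 1 (cochain2 m1) xs = 0 \<and>
     balavoine scale \<alpha> 1 (cochain2 m0) 1 (cochain2 \<mu>1) xs
      + balavoine scale \<alpha> 1 (cochain2 \<mu>0) 1 (cochain2 m1) xs = 0" for xs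
  proof (cases "length xs = 3")
    case True
    then obtain x y z where "xs = [x, y, z]"
      by (auto simp: numeral_3_eq_3 length_Suc_conv)
    then show ?thesis
      using J1[of x y z] J2[of x y z] J3[of x y z]
      by (simp only: balavoine_1_1 minus_add_distrib[symmetric]) simp
  next
    case False
    then show ?thesis
      by (simp add: balavoine_eq_0_length)
  qed
  have "[1..<2 + 2] = [1, 2, 3]"
    by (simp add: upt_rec)
  then have "differential scale \<alpha> \<mu>0 m0 2 [cochain2 \<mu>1, cochain2 m1] = replicate 3 (\<lambda>xs. 0)"
    using bracket by (simp add: differential_def numeral_3_eq_3 del: minus_add_distrib)
  then show ?thesis
    using cochains by (simp add: cocycles_def kernel_def LC_def)
qed

section \<open>Equivalences and coboundaries\<close>

lemma differential_1:
  "differential scale \<alpha> \<mu> m 1 [f] =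
     [balavoine scale \<alpha> 1 (cochain2 \<mu>) 0 f, balavoine scale \<alpha> 1 (cochain2 m) 0 f]"
  by (simp add: differential_def upt_rec)

lemma homomorphism_linear_coeff:
  assumes N: "Vector_Spaces.linear scale scale N"
    and "bilinear_over scale P" "bilinear_over scale P1'"
    and hom: "\<And>t x y. deform scale P P1 t x y + t *s N (deform scale P P1 t x y) =
        deform scale P P1' t (x + t *s N x) (y + t *s N y)"
  shows "P1 x y = P (N x) y + P x (N y) - N (P x y) + P1' x y"
proof -
  interpret N: Vector_Spaces.linear scale scale N by (fact N)
  note bilinear = assms(2,3)[THEN bilinear_over_add(1)] assms(2,3)[THEN bilinear_over_add(2)]
    assms(2,3)[THEN bilinear_over_scale(1)] assms(2,3)[THEN bilinear_over_scale(2)]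
  \<comment> \<open>The terms free of t cancel because both deformations start from the same
    \<open>P\<close>.\<close>
  have "P1 x y - (P (N x) y + P x (N y) - N (P x y) + P1' x y) = 0"
  proof (rule linear_coeff_eq_0)
    fix t
    show "t *s (P1 x y - (P (N x) y + P x (N y) - N (P x y) + P1' x y))
      + (t * t) *s (N (P1 x y) - P (N x) (N y) - P1' (N x) y - P1' x (N y))
      + (t * t * t) *s (- P1' (N x) (N y)) = 0"
      using hom[of t x y]
      by (simp add: deform_def bilinear N.add N.scale algebra_simps)
  qed
  then show ?thesis by simp
qed

text \<open>The hypotheses on the brackets say that the two pairs differ by the differential of
  \<open>N\<close>, and commuting with \<open>\<alpha>\<close> makes \<open>N\<close> a
  1-cochain.\<close>

lemma coboundary_coset_memI:
  assumes N: "Vector_Spaces.linear scale scale N" "\<And>x. \<alpha> (N x) = N (\<alpha> x)"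
    and \<mu>: "\<And>x y. \<mu>1 x y = \<mu>0 (N x) y + \<mu>0 x (N y) - N (\<mu>0 x y) + \<mu>1' x y"
    and m: "\<And>x y. m1 x y = m0 (N x) y + m0 x (N y) - N (m0 x y) + m1' x y"
  shows "[cochain2 \<mu>1, cochain2 m1] \<in>
    coboundaries scale \<alpha> \<mu>0 m0 2 #>\<^bsub>LC scale \<alpha> 2\<^esub> [cochain2 \<mu>1', cochain2 m1']"
proof -
  \<comment> \<open>\<open>N\<close> encoded as a cochain, with the value 0 required off length
    1.\<close>
  define f where "f xs = (if length xs = 1 then N (xs ! 0) else 0)" for xs
  have "f \<in> cochains scale \<alpha> 1"
    unfolding cochains_def f_def using N by simp
  then have coboundary: "differential scale \<alpha> \<mu>0 m0 1 [f] \<in> coboundaries scale \<alpha> \<mu>0 m0 2"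
    by (simp add: coboundaries_def LC_def)
  have bracket: "cochain2 P1 = (\<lambda>xs. balavoine scale \<alpha> 1 (cochain2 P) 0 f xs + cochain2 P1' xs)"
    if P1: "\<And>x y. P1 x y = P (N x) y + P x (N y) - N (P x y) + P1' x y" for P P1 P1'
  proof
    fix xs
    show "cochain2 P1 xs = balavoine scale \<alpha> 1 (cochain2 P) 0 f xs + cochain2 P1' xs"
    proof (cases "length xs = 2")
      case True
      then obtain x y where "xs = [x, y]"
        by (auto simp: numeral_2_eq_2 length_Suc_conv)
      then show ?thesis
        by (simp only: balavoine_1_0) (simp add: f_def cochain2_def P1)
    next
      case False
      then show ?thesis
        by (simp add: balavoine_eq_0_length cochain2_def)
    qed
  qed
  have "[cochain2 \<mu>1, cochain2 m1] = differential scale \<alpha> \<mu>0 m0 1 [f]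
      \<otimes>\<^bsub>LC scale \<alpha> 2\<^esub> [cochain2 \<mu>1', cochain2 m1']"
    unfolding differential_1 bracket[of \<mu>1 \<mu>0 \<mu>1', OF \<mu>] bracket[of m1 m0 m1', OF m]
    by (simp add: LC_def)
  with coboundary show ?thesis
    by (auto simp: r_coset_def)
qed

text \<open>Right cosets depend only on the multiplication, which is unchanged when the carrier of
  \<open>LC\<close> is restricted to the cocycles.\<close>

lemma coset_in_cohomology:
  assumes "c \<in> cocycles scale \<alpha> \<mu> m n"
  shows "coboundaries scale \<alpha> \<mu> m n #>\<^bsub>LC scale \<alpha> n\<^esub> c \<in> carrier (cohomology scale \<alpha> \<mu> m n)"
  using assms by (auto simp: cohomology_def FactGroup_def RCOSETS_def r_coset_def)

end

theorem theorem5p2: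
  fixes scale :: "'k::field_char_0 \<Rightarrow> 'v::ab_group_add \<Rightarrow> 'v"
    and \<alpha> :: "'v \<Rightarrow> 'v"
    and \<mu>0 m0 \<mu>1 m1 \<mu>1' m1' :: "'v \<Rightarrow> 'v \<Rightarrow> 'v"
  assumes "compatible_hom_leibniz_algebra scale \<mu>0 m0 \<alpha>"
    and "generates_infinitesimal_deformation scale \<alpha> \<mu>0 m0 \<mu>1 m1"
    and "generates_infinitesimal_deformation scale \<alpha> \<mu>0 m0 \<mu>1' m1'"
    and "equivalent_deformations scale \<alpha> \<mu>0 m0 \<mu>1 m1 \<mu>1' m1'"
  shows "\<exists>c \<in> carrier (cohomology scale \<alpha> \<mu>0 m0 2).
           [cochain2 \<mu>1, cochain2 m1] \<in> c \<and> [cochain2 \<mu>1', cochain2 m1'] \<in> c"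
proof -
  interpret compatible_hom_leibniz_algebra scale \<mu>0 m0 \<alpha> by (fact assms(1))
  interpret \<alpha>: Vector_Spaces.linear scale scale \<alpha> by (rule first.\<alpha>_linear)
  note vs = first.vector_space_axioms
  note pair = vector_space_pair.intro[OF vs vs]
  obtain N where N: "Vector_Spaces.linear scale scale N"
    and hom: "\<And>t. compatible_hom_leibniz_hom
        scale (deform scale \<mu>0 \<mu>1 t) (deform scale m0 m1 t) \<alpha>
        scale (deform scale \<mu>0 \<mu>1' t) (deform scale m0 m1' t) \<alpha>
        (\<lambda>x. x + scale t (N x))"
    using assms(4) by (auto simp: equivalent_deformations_def)
  have cochains': "cochain2 \<mu>1' \<in> cochains scale \<alpha> 2" "cochain2 m1' \<in> cochains scale \<alpha> 2"
    using assms(3) by (simp_all add: generates_infinitesimal_deformation_def)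
  \<comment> \<open>At t = 1 the term \<open>\<alpha> x\<close> cancels from both sides.\<close>
  have N\<alpha>: "\<alpha> (N x) = N (\<alpha> x)" for x
    using compatible_hom_leibniz_hom.\<phi>_\<alpha>[OF hom[of 1], THEN fun_cong, of x]
    by (simp add: \<alpha>.add)
  have \<mu>: "\<mu>1 x y = \<mu>0 (N x) y + \<mu>0 x (N y) - N (\<mu>0 x y) + \<mu>1' x y" for x y
    using vs N first.bilinear_over_br cochains'(1)[THEN bilinear_over_cochain2]
      compatible_hom_leibniz_hom.\<phi>_\<mu>[OF hom]
    by (rule homomorphism_linear_coeff)
  have m: "m1 x y = m0 (N x) y + m0 x (N y) - N (m0 x y) + m1' x y" for x y
    using vs N second.bilinear_over_br cochains'(2)[THEN bilinear_over_cochain2]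
      compatible_hom_leibniz_hom.\<phi>_m[OF hom]
    by (rule homomorphism_linear_coeff)
  \<comment> \<open>The common class is represented by the primed pair, a cocycle since it generates
    a deformation.\<close>
  let ?c = "coboundaries scale \<alpha> \<mu>0 m0 2 #>\<^bsub>LC scale \<alpha> 2\<^esub> [cochain2 \<mu>1', cochain2 m1']"
  have "[cochain2 \<mu>1, cochain2 m1] \<in> ?c"
    using vs N N\<alpha> \<mu> m by (rule coboundary_coset_memI)
  \<comment> \<open>The same criterion with \<open>N = 0\<close>: the representative differs from
    itself by a zero coboundary.\<close>
  moreover have "[cochain2 \<mu>1', cochain2 m1'] \<in> ?c"
    by (rule coboundary_coset_memI[OF vs vector_space_pair.linear_zero[OF pair]])
      (simp_all add: \<alpha>.zero first.br_zero second.br_zero)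
  ultimately show ?thesis
    using coset_in_cohomology[OF vs deformation_generator_in_cocycles[OF vs assms(1,3)]] by blast
qed

end
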